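(* There exists no elliptic curve $E$ over $\mathbb{Q}$ that has a $\mathbb{Q}$-rational point of order $10$ and whose conductor is $N_E=p^{\alpha}q^{\beta}$, where $p\neq q$ are primes and $\alpha,\beta>0$ are integers.
   Context: For an elliptic curve $E/\mathbb{Q}$, $N_E$ denotes its conductor. *)

theory Defs
  imports
    Complex_Main
    "HOL-Computational_Algebra.Computational_Algebra"
    "HOL-Algebra.QuotRing"
    "HOL-Algebra.Ideal_Product"
    "HOL-Algebra.Generated_Fields"
    "HOL-Algebra.Algebraic_Closure_Type"
begin

hide_const (open) Divisibility.prime

section \<open>Weierstrass equations\<close>

text \<open>
  \<open>Weierstrass a1 a2 a3 a4 a6\<close> stands for the equation
  \<open>y\<^sup>2 + a1 x y + a3 y = x\<^sup>3 + a2 x\<^sup>2 + a4 x + a6\<close>. Every elliptic curve over a field is isomorphic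
  to a Weierstrass curve with nonzero discriminant, with the point at infinity as the origin.
\<close>

datatype 'a weierstrass = Weierstrass (a1: 'a) (a2: 'a) (a3: 'a) (a4: 'a) (a6: 'a)

definition b2 :: "'a::comm_ring_1 weierstrass \<Rightarrow> 'a" where
  "b2 E = a1 E ^ 2 + 4 * a2 E"

definition b4 :: "'a::comm_ring_1 weierstrass \<Rightarrow> 'a" where
  "b4 E = 2 * a4 E + a1 E * a3 E"

definition b6 :: "'a::comm_ring_1 weierstrass \<Rightarrow> 'a" where
  "b6 E = a3 E ^ 2 + 4 * a6 E"

definition b8 :: "'a::comm_ring_1 weierstrass \<Rightarrow> 'a" where
  "b8 E = a1 E ^ 2 * a6 E + 4 * a2 E * a6 E - a1 E * a3 E * a4 E + a2 E * a3 E ^ 2 - a4 E ^ 2"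

definition c4 :: "'a::comm_ring_1 weierstrass \<Rightarrow> 'a" where
  "c4 E = b2 E ^ 2 - 24 * b4 E"

definition disc :: "'a::comm_ring_1 weierstrass \<Rightarrow> 'a" where
  "disc E = - (b2 E ^ 2 * b8 E) - 8 * b4 E ^ 3 - 27 * b6 E ^ 2 + 9 * b2 E * b4 E * b6 E"

definition elliptic_curve :: "'a::field weierstrass \<Rightarrow> bool" where
  "elliptic_curve E \<longleftrightarrow> disc E \<noteq> 0"

text \<open>
  Isomorphism over the ground field: \<open>E'\<close> arises from \<open>E\<close> by the substitution
  \<open>x = u\<^sup>2 x' + r\<close>, \<open>y = u\<^sup>3 y' + s u\<^sup>2 x' + t\<close>.
\<close>

definition weierstrass_iso :: "'a::field weierstrass \<Rightarrow> 'a weierstrass \<Rightarrow> bool" where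
  "weierstrass_iso E E' \<longleftrightarrow> (\<exists>u r s t. u \<noteq> 0 \<and>
     u * a1 E' = a1 E + 2 * s \<and>
     u ^ 2 * a2 E' = a2 E - s * a1 E + 3 * r - s ^ 2 \<and>
     u ^ 3 * a3 E' = a3 E + r * a1 E + 2 * t \<and>
     u ^ 4 * a4 E' = a4 E - s * a3 E + 2 * r * a2 E - (t + r * s) * a1 E + 3 * r ^ 2 - 2 * s * t \<and>
     u ^ 6 * a6 E' = a6 E + r * a4 E + r ^ 2 * a2 E + r ^ 3 - t * a3 E - t ^ 2 - r * t * a1 E)"

section \<open>Points and the group law\<close>

datatype 'a point = Infinity | Affine 'a 'a

fun on_curve :: "'a::field weierstrass \<Rightarrow> 'a point \<Rightarrow> bool" where
  "on_curve E Infinity \<longleftrightarrow> True"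
| "on_curve E (Affine x y) \<longleftrightarrow>
     y ^ 2 + a1 E * x * y + a3 E * y = x ^ 3 + a2 E * x ^ 2 + a4 E * x + a6 E"

text \<open>
  The chord-tangent law. In the first case the second point is the negative of the first;
  \<open>m\<close> is the slope of the chord or tangent through the two points.
\<close>

fun add_points :: "'a::field weierstrass \<Rightarrow> 'a point \<Rightarrow> 'a point \<Rightarrow> 'a point" where
  "add_points E Infinity Q = Q"
| "add_points E (Affine x1 y1) Infinity = Affine x1 y1"
| "add_points E (Affine x1 y1) (Affine x2 y2) =
     (if x1 = x2 \<and> y1 + y2 + a1 E * x2 + a3 E = 0 then Infinity
      else
        let m = (if x1 = x2
                 then (3 * x1 ^ 2 + 2 * a2 E * x1 + a4 E - a1 E * y1) / (2 * y1 + a1 E * x1 + a3 E)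
                 else (y2 - y1) / (x2 - x1));
            x3 = m ^ 2 + a1 E * m - a2 E - x1 - x2
        in Affine x3 (- (m * (x3 - x1) + y1) - a1 E * x3 - a3 E))"

definition multiple :: "'a::field weierstrass \<Rightarrow> nat \<Rightarrow> 'a point \<Rightarrow> 'a point" where
  "multiple E n P = (add_points E P ^^ n) Infinity"

definition point_has_order :: "'a::field weierstrass \<Rightarrow> 'a point \<Rightarrow> nat \<Rightarrow> bool" where
  "point_has_order E P n \<longleftrightarrow>
     n > 0 \<and> multiple E n P = Infinity \<and> (\<forall>k. 0 < k \<and> k < n \<longrightarrow> multiple E k P \<noteq> Infinity)"

section \<open>Reduction types of elliptic curves over the rationals\<close>

text \<open>
  Minimality at \<open>p\<close> may be tested on models with coefficients in \<open>\<int>\<close> rather than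
  in \<open>\<int>\<close> localised at \<open>p\<close>: denominators prime to \<open>p\<close> can be cleared by a substitution with
  \<open>u\<inverse>\<close> an integer prime to \<open>p\<close>, which does not change the valuation of the discriminant.
\<close>

definition minimal_model_at :: "nat \<Rightarrow> rat weierstrass \<Rightarrow> int weierstrass \<Rightarrow> bool" where
  "minimal_model_at p E W \<longleftrightarrow>
     weierstrass_iso E (map_weierstrass of_int W) \<and>
     (\<forall>W'. weierstrass_iso E (map_weierstrass of_int W') \<longrightarrow>
        multiplicity (int p) (disc W) \<le> multiplicity (int p) (disc W'))"

text \<open>
  The reduction modulo \<open>p\<close> of a minimal model is smooth iff its discriminant is nonzero; it has
  a node iff its discriminant vanishes and its \<open>c4\<close> does not, and otherwise a cusp.
\<close>

definition good_reduction :: "rat weierstrass \<Rightarrow> nat \<Rightarrow> bool" where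
  "good_reduction E p \<longleftrightarrow> (\<exists>W. minimal_model_at p E W \<and> \<not> int p dvd disc W)"

definition multiplicative_reduction :: "rat weierstrass \<Rightarrow> nat \<Rightarrow> bool" where
  "multiplicative_reduction E p \<longleftrightarrow>
     (\<exists>W. minimal_model_at p E W \<and> int p dvd disc W \<and> \<not> int p dvd c4 W)"

section \<open>Ramification groups of number fields\<close>

text \<open>Number fields are subfields \<open>K\<close> of \<open>\<complex>\<close>.\<close>

abbreviation subring_of_complex :: "complex set \<Rightarrow> complex ring" where
  "subring_of_complex K \<equiv> ring_of_type_algebra\<lparr>carrier := K\<rparr>"

definition integers_of :: "complex set \<Rightarrow> complex set" where
  "integers_of K = {x \<in> K. algebraic_int x}"

text \<open>Every field automorphism of \<open>K\<close> fixes \<open>\<rat>\<close>; extensionality makes it unique as a function.\<close>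

definition galois_group :: "complex set \<Rightarrow> (complex \<Rightarrow> complex) set" where
  "galois_group K = ring_iso (subring_of_complex K) (subring_of_complex K) \<inter> extensional K"

text \<open>
  If \<open>K\<close> is Galois over \<open>\<rat>\<close>, the primes above \<open>p\<close> are conjugate, and the orders of the
  ramification groups and of their fixed modules do not depend on the choice.
\<close>

definition prime_above :: "complex set \<Rightarrow> nat \<Rightarrow> complex set" where
  "prime_above K p =
     (SOME P. primeideal P (subring_of_complex (integers_of K)) \<and> of_nat p \<in> P)"

definition ideal_power :: "complex set \<Rightarrow> complex set \<Rightarrow> nat \<Rightarrow> complex set" where
  "ideal_power R P n = (ideal_prod (subring_of_complex R) P ^^ n) R"

text \<open>
  The ramification groups in lower numbering; they are those of the completion of \<open>K\<close> at the
  chosen prime over \<open>\<rat>\<^sub>p\<close>. Index \<open>0\<close> gives the inertia group.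
\<close>

definition ramification_group :: "complex set \<Rightarrow> nat \<Rightarrow> nat \<Rightarrow> (complex \<Rightarrow> complex) set" where
  "ramification_group K p i =
     {\<sigma> \<in> galois_group K. \<forall>x \<in> integers_of K.
        \<sigma> x - x \<in> ideal_power (integers_of K) (prime_above K p) (Suc i)}"

section \<open>The conductor\<close>

definition torsion_points :: "rat weierstrass \<Rightarrow> nat \<Rightarrow> complex point set" where
  "torsion_points E l = (let E' = map_weierstrass of_rat E in
     {P. on_curve E' P \<and> multiple E' l P = Infinity})"

definition torsion_field :: "rat weierstrass \<Rightarrow> nat \<Rightarrow> complex set" where
  "torsion_field E l =
     generate_field ring_of_type_algebra (\<Union>P \<in> torsion_points E l. set_point P)"

text \<open>The dimension over \<open>\<int>/l\<int>\<close> of the quotient of \<open>E[l]\<close> by its \<open>G\<close>-invariants.\<close>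

definition fixed_codim ::
    "rat weierstrass \<Rightarrow> nat \<Rightarrow> (complex \<Rightarrow> complex) set \<Rightarrow> nat" where
  "fixed_codim E l G = (THE d. card (torsion_points E l) =
     l ^ d * card {P \<in> torsion_points E l. \<forall>\<sigma> \<in> G. map_point \<sigma> P = P})"

text \<open>
  The exponent of wild ramification is the sum over \<open>i \<ge> 1\<close> of
  \<open>|G\<^sub>i| / |G\<^sub>0| \<cdot> dim (E[l] / E[l]\<^bsup>G\<^sub>i\<^esup>)\<close>, where \<open>G\<^sub>i\<close> are the ramification groups at \<open>p\<close> of
  \<open>\<rat>(E[l])\<close> over \<open>\<rat>\<close> and \<open>l \<noteq> p\<close> is prime. The value is an integer, so that the division below
  is exact, and it does not depend on \<open>l\<close>; hence a fixed choice of \<open>l\<close> suffices.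
  Only finitely many summands are nonzero, and the sum is taken over these. For \<open>p \<ge> 5\<close> the
  value is \<open>0\<close>.
\<close>

definition wild_exponent_via :: "rat weierstrass \<Rightarrow> nat \<Rightarrow> nat \<Rightarrow> nat" where
  "wild_exponent_via E p l =
     (let G = ramification_group (torsion_field E l) p
      in (\<Sum>i | i \<ge> 1 \<and> fixed_codim E l (G i) \<noteq> 0. card (G i) * fixed_codim E l (G i))
           div card (G 0))"

definition wild_exponent :: "rat weierstrass \<Rightarrow> nat \<Rightarrow> nat" where
  "wild_exponent E p = wild_exponent_via E p (if p = 2 then 3 else 2)"

definition conductor_exponent :: "rat weierstrass \<Rightarrow> nat \<Rightarrow> nat" where
  "conductor_exponent E p =
     (if good_reduction E p then 0
      else if multiplicative_reduction E p then 1
      else 2 + wild_exponent E p)"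

definition conductor :: "rat weierstrass \<Rightarrow> nat" where
  "conductor E = (\<Prod>p | prime p \<and> conductor_exponent E p \<noteq> 0. p ^ conductor_exponent E p)"

end

theory Submission
  imports Defs
begin

text \<open>
  The modular curve \<open>X\<^sub>1(10)\<close> is rational, and moving the point of order 10 to the origin of a Tate
  normal form gives an integral model with coprime integer parameters \<open>m\<close>, \<open>n\<close> and
  discriminant \<open>m\<^sup>1\<^sup>0 (m - n)\<^sup>1\<^sup>0 n\<^sup>5 (2m - n)\<^sup>5 Q\<^sub>1\<^sup>2 Q\<^sub>2\<close>, where \<open>Q\<^sub>1 = m\<^sup>2 - 3mn + n\<^sup>2\<close> and
  \<open>Q\<^sub>2 = 4m\<^sup>2 - 2mn - n\<^sup>2\<close>. Isomorphic models have discriminants and \<open>c4\<close> differing by a twelfth and a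
  fourth power, which shows that 2 and every prime dividing one of the factors is bad. Away from 2 the four
  linear factors are coprime to \<open>Q\<^sub>1 Q\<^sub>2\<close>; both products have an odd prime divisor, as otherwise
  \<open>(m, n)\<close> is a cusp. So there are always at least three bad primes. A prime divides the
  conductor iff it is bad, regardless of the wild part.
\<close>

section \<open>Change of variables\<close>

text \<open>The quadruple that \<open>weierstrass_iso\<close> quantifies away is kept visible,
  because points are transported and scalings are compared through it.\<close>

definition weierstrass_subst ::
    "'a::field \<Rightarrow> 'a \<Rightarrow> 'a \<Rightarrow> 'a \<Rightarrow> 'a weierstrass \<Rightarrow> 'a weierstrass \<Rightarrow> bool" where
  "weierstrass_subst u r s t E E' \<longleftrightarrow> u \<noteq> 0 \<and>
     u * a1 E' = a1 E + 2 * s \<and>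
     u ^ 2 * a2 E' = a2 E - s * a1 E + 3 * r - s ^ 2 \<and>
     u ^ 3 * a3 E' = a3 E + r * a1 E + 2 * t \<and>
     u ^ 4 * a4 E' = a4 E - s * a3 E + 2 * r * a2 E - (t + r * s) * a1 E + 3 * r ^ 2 - 2 * s * t \<and>
     u ^ 6 * a6 E' = a6 E + r * a4 E + r ^ 2 * a2 E + r ^ 3 - t * a3 E - t ^ 2 - r * t * a1 E"

lemma weierstrass_iso_iff_subst:
  "weierstrass_iso E E' \<longleftrightarrow> (\<exists>u r s t. weierstrass_subst u r s t E E')"
  by (simp add: weierstrass_iso_def weierstrass_subst_def)

text \<open>Solved for \<open>E\<close> in triangular form: each right-hand side mentions only
  earlier coefficients of \<open>E\<close>, so repeated unfolding ends in an expression in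
  \<open>E'\<close> alone.\<close>

lemma weierstrass_subst_coeffs:
  assumes "weierstrass_subst u r s t E E'"
  shows "a1 E = u * a1 E' - 2 * s"
    "a2 E = u ^ 2 * a2 E' + s * a1 E - 3 * r + s ^ 2"
    "a3 E = u ^ 3 * a3 E' - r * a1 E - 2 * t"
    "a4 E = u ^ 4 * a4 E' + s * a3 E - 2 * r * a2 E + (t + r * s) * a1 E - 3 * r ^ 2 + 2 * s * t"
    "a6 E = u ^ 6 * a6 E' - r * a4 E - r ^ 2 * a2 E - r ^ 3 + t * a3 E + t ^ 2 + r * t * a1 E"
  using assms by (simp_all add: weierstrass_subst_def)

lemma b_subst:
  assumes "weierstrass_subst u r s t E E'"
  shows "b2 E = u ^ 2 * b2 E' - 12 * r"
    "b4 E = u ^ 4 * b4 E' - r * b2 E - 6 * r ^ 2"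
    "b6 E = u ^ 6 * b6 E' - 2 * r * b4 E - r ^ 2 * b2 E - 4 * r ^ 3"
    "b8 E = u ^ 8 * b8 E' - 3 * r * b6 E - 3 * r ^ 2 * b4 E - r ^ 3 * b2 E - 3 * r ^ 4"
  unfolding b2_def b4_def b6_def b8_def weierstrass_subst_coeffs[OF assms]
  by Groebner_Basis.algebra+

lemma c4_subst:
  assumes "weierstrass_subst u r s t E E'"
  shows "c4 E = u ^ 4 * c4 E'"
  unfolding c4_def b_subst[OF assms] by Groebner_Basis.algebra

text \<open>With the b-invariants treated as unknowns, the transformation of \<open>disc\<close>
  under a shift by \<open>r\<close> holds only modulo this relation.\<close>

lemma b8_relation: "4 * b8 E = b2 E * b6 E - b4 E ^ 2"
  unfolding b2_def b4_def b6_def b8_def by (simp add: algebra_simps eval_nat_numeral)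

lemma disc_subst:
  assumes "weierstrass_subst u r s t E E'"
  shows "disc E = u ^ 12 * disc E'"
  using b8_relation[of E'] unfolding disc_def b_subst[OF assms] by Groebner_Basis.algebra

section \<open>Changes of variables respect the group law\<close>

fun subst_point :: "'a::field \<Rightarrow> 'a \<Rightarrow> 'a \<Rightarrow> 'a \<Rightarrow> 'a point \<Rightarrow> 'a point" where
  "subst_point u r s t Infinity = Infinity"
| "subst_point u r s t (Affine x y) = Affine (u ^ 2 * x + r) (u ^ 3 * y + s * u ^ 2 * x + t)"

text \<open>This sum vanishes exactly when two points with the same abscissa are opposite, and with
  \<open>y' = y\<close> it is the denominator of the tangent slope. It governs both the case split
  and the tangent in \<open>add_points\<close>.\<close>

lemma double_ordinate_subst:
  assumes "weierstrass_subst u r s t E E'"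
  shows "u ^ 3 * y + s * u ^ 2 * x + t + (u ^ 3 * y' + s * u ^ 2 * x + t) + a1 E * (u ^ 2 * x + r) + a3 E
    = u ^ 3 * (y + y' + a1 E' * x + a3 E')"
  unfolding weierstrass_subst_coeffs[OF assms] by Groebner_Basis.algebra

text \<open>For a fixed abscissa the equation is quadratic in the ordinate, and its two roots add up
  to \<open>- a1 E * x - a3 E\<close>.\<close>

lemma on_curve_same_x:
  assumes "on_curve E (Affine x y)" "on_curve E (Affine x y')"
  shows "y = y' \<or> y + y' + a1 E * x + a3 E = 0"
proof -
  have "(y - y') * (y + y' + a1 E * x + a3 E) = 0"
    using assms by simp Groebner_Basis.algebra
  then show ?thesis by auto
qed

text \<open>The map goes from \<open>E'\<close> to \<open>E\<close> and sends a line of slope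
  \<open>m\<close> to one of slope \<open>u * m + s\<close>. Membership in the curve forces equal
  points in the tangent case, where the formula for the slope reads only one ordinate.\<close>

lemma add_points_subst:
  assumes sub: "weierstrass_subst u r s t E E'"
    and "on_curve E' P" "on_curve E' Q"
  shows "add_points E (subst_point u r s t P) (subst_point u r s t Q)
    = subst_point u r s t (add_points E' P Q)"
proof (cases P)
  case Infinity
  then show ?thesis by simp
next
  case P: (Affine x y)
  show ?thesis
  proof (cases Q)
    case Infinity
    then show ?thesis using P by simp
  next
    case Q: (Affine x' y')
    have u: "u \<noteq> 0" using sub by (simp add: weierstrass_subst_def)
    show ?thesis
    proof (cases "x = x' \<and> y + y' + a1 E' * x' + a3 E' = 0")
      case True
      then show ?thesis
        using P Q double_ordinate_subst[OF sub, of y x y'] by simp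
    next
      case False
      define m where "m = (if x = x' then (3 * x ^ 2 + 2 * a2 E' * x + a4 E' - a1 E' * y) / (2 * y + a1 E' * x + a3 E')
          else (y' - y) / (x' - x))"
      define xE where "xE = u ^ 2 * x + r"
      define xE' where "xE' = u ^ 2 * x' + r"
      define yE where "yE = u ^ 3 * y + s * u ^ 2 * x + t"
      define yE' where "yE' = u ^ 3 * y' + s * u ^ 2 * x' + t"
      have same_x: "xE = xE' \<longleftrightarrow> x = x'" using u by (simp add: xE_def xE'_def)
      have neg: "\<not> (xE = xE' \<and> yE + yE' + a1 E * xE' + a3 E = 0)"
      proof
        assume *: "xE = xE' \<and> yE + yE' + a1 E * xE' + a3 E = 0"
        then have x: "x = x'" using same_x by simp
        have "yE + yE' + a1 E * xE' + a3 E = u ^ 3 * (y + y' + a1 E' * x' + a3 E')"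
          unfolding x xE'_def yE_def yE'_def by (rule double_ordinate_subst[OF sub])
        then show False using u False x * by simp
      qed
      have slope: "(if xE = xE' then (3 * xE ^ 2 + 2 * a2 E * xE + a4 E - a1 E * yE) / (2 * yE + a1 E * xE + a3 E)
          else (yE' - yE) / (xE' - xE)) = u * m + s"
      proof (cases "x = x'")
        case True
        then have "on_curve E' (Affine x y)" "on_curve E' (Affine x y')"
          using assms(2,3) unfolding P Q True by (simp_all only:)
        note oc = on_curve_same_x[OF this]
        have ne: "y + y' + a1 E' * x + a3 E' \<noteq> 0"
          using False True by blast
        then have "y = y'" using oc by blast
        then have nz: "2 * y + a1 E' * x + a3 E' \<noteq> 0"
          using ne unfolding mult_2 by blast
        have den: "2 * yE + a1 E * xE + a3 E = u ^ 3 * (2 * y + a1 E' * x + a3 E')"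
          using double_ordinate_subst[OF sub, of y x y] unfolding xE_def yE_def mult_2 .
        have m: "m * (2 * y + a1 E' * x + a3 E') = 3 * x ^ 2 + 2 * a2 E' * x + a4 E' - a1 E' * y"
          using True nz by (simp add: m_def)
        have "3 * xE ^ 2 + 2 * a2 E * xE + a4 E - a1 E * yE
          = u ^ 4 * (3 * x ^ 2 + 2 * a2 E' * x + a4 E' - a1 E' * y)
            + s * u ^ 3 * (2 * y + a1 E' * x + a3 E')"
          unfolding weierstrass_subst_coeffs[OF sub] xE_def yE_def by Groebner_Basis.algebra
        also have "\<dots> = (u * m + s) * (u ^ 3 * (2 * y + a1 E' * x + a3 E'))"
          unfolding m[symmetric] by Groebner_Basis.algebra
        finally show ?thesis
          using True same_x den nz u by simp
      next
        case False
        have "m * (x' - x) = y' - y" using False by (simp add: m_def)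
        then have "yE' - yE = (u * m + s) * (xE' - xE)"
          unfolding xE_def xE'_def yE_def yE'_def by Groebner_Basis.algebra
        then show ?thesis using False same_x by simp
      qed
      define x3 where "x3 = m ^ 2 + a1 E' * m - a2 E' - x - x'"
      define y3 where "y3 = - (m * (x3 - x) + y) - a1 E' * x3 - a3 E'"
      define X3 where "X3 = (u * m + s) ^ 2 + a1 E * (u * m + s) - a2 E - xE - xE'"
      have l: "add_points E' P Q = Affine x3 y3"
        using False P Q by (simp add: x3_def y3_def m_def Let_def)
      have "subst_point u r s t P = Affine xE yE" "subst_point u r s t Q = Affine xE' yE'"
        using P Q by (simp_all add: xE_def xE'_def yE_def yE'_def)
      then have 1: "add_points E (subst_point u r s t P) (subst_point u r s t Q)
        = Affine X3 (- ((u * m + s) * (X3 - xE) + yE) - a1 E * X3 - a3 E)"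
        using neg slope by (simp only: add_points.simps if_False Let_def X3_def)
      have 2: "X3 = u ^ 2 * x3 + r"
        unfolding X3_def x3_def xE_def xE'_def weierstrass_subst_coeffs[OF sub] by Groebner_Basis.algebra
      have 3: "- ((u * m + s) * (X3 - xE) + yE) - a1 E * X3 - a3 E = u ^ 3 * y3 + s * u ^ 2 * x3 + t"
        unfolding 2 y3_def xE_def yE_def weierstrass_subst_coeffs[OF sub] by Groebner_Basis.algebra
      show ?thesis unfolding 1 l 3 by (simp add: 2)
    qed
  qed
qed

section \<open>Multiples of a point at the origin\<close>

fun neg_point :: "'a::field weierstrass \<Rightarrow> 'a point \<Rightarrow> 'a point" where
  "neg_point E Infinity = Infinity"
| "neg_point E (Affine x y) = Affine x (- y - a1 E * x - a3 E)"

lemma neg_neg_point [simp]: "neg_point E (neg_point E P) = P"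
  by (cases P) auto

lemma multiple_0 [simp]: "multiple E 0 P = Infinity"
  by (simp add: multiple_def)

lemma multiple_Suc: "multiple E (Suc n) P = add_points E P (multiple E n P)"
  by (simp add: multiple_def)

text \<open>The origin lies on the curve (\<open>a6 = 0\<close>), has the horizontal tangent
  \<open>y = 0\<close> (\<open>a4 = 0\<close>), and is not its own negative (\<open>a3\<close>
  nonzero).\<close>

locale origin_curve =
  fixes E :: "'a::field weierstrass"
  assumes a4 [simp]: "a4 E = 0" and a6 [simp]: "a6 E = 0" and a3: "a3 E \<noteq> 0"
begin

abbreviation origin :: "'a point" where "origin \<equiv> Affine 0 0"

lemma add_origin_neg_origin [simp]: "add_points E origin (Affine 0 (- a3 E)) = Infinity"
  by simp

lemma add_origin_origin [simp]:
  "add_points E origin origin = Affine (- a2 E) (a1 E * a2 E - a3 E)"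
  using a3 by simp

lemma add_origin_chord:
  assumes "x \<noteq> 0" "y = m * x"
  shows "add_points E origin (Affine x y) =
    neg_point E (Affine (m ^ 2 + a1 E * m - a2 E - x) (m * (m ^ 2 + a1 E * m - a2 E - x)))"
  using assms by (simp add: Let_def)

lemma on_curve_zero_cases:
  assumes "on_curve E (Affine 0 y)"
  shows "y = 0 \<or> y = - a3 E"
proof -
  have "y * (y + a3 E) = 0" using assms by simp Groebner_Basis.algebra
  then show ?thesis by (auto simp: eq_neg_iff_add_eq_0)
qed

text \<open>Vieta: on the line \<open>y = m x\<close> the equation, divided by \<open>x\<close>, is
  a quadratic whose roots have sum \<open>m ^ 2 + a1 E * m - a2 E\<close> and product
  \<open>- a3 E * m\<close>.\<close>

lemma chord_relation:
  assumes "on_curve E (Affine x (m * x))" "x \<noteq> 0"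
  shows "x * (m ^ 2 + a1 E * m - a2 E - x) = - a3 E * m"
proof -
  have "x * (x * (m ^ 2 + a1 E * m - a2 E - x) + a3 E * m) = 0"
    using assms(1) by simp Groebner_Basis.algebra
  then show ?thesis using assms(2) by (simp add: eq_neg_iff_add_eq_0)
qed

lemma on_curve_neg_point: "on_curve E (neg_point E P) \<longleftrightarrow> on_curve E P"
proof (cases P)
  case (Affine x y)
  show ?thesis unfolding Affine by simp Groebner_Basis.algebra
qed simp

lemma point_cases [case_names Infinity origin neg_origin chord]:
  assumes "on_curve E P"
  obtains "P = Infinity" | "P = origin" | "P = Affine 0 (- a3 E)"
  | x m where "P = Affine x (m * x)" "x \<noteq> 0"
proof (cases P)
  case (Affine x y)
  show ?thesis
  proof (cases "x = 0")
    case True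
    then show ?thesis using Affine assms on_curve_zero_cases that by metis
  next
    case False
    then have "P = Affine x ((y / x) * x)" using Affine by simp
    then show ?thesis using False that by blast
  qed
qed (use that in auto)

lemma on_curve_add_origin:
  assumes "on_curve E P"
  shows "on_curve E (add_points E origin P)"
  using assms
proof (cases rule: point_cases)
  case origin
  show ?thesis unfolding origin add_origin_origin by simp Groebner_Basis.algebra
next
  case (chord x m)
  define z where "z = m ^ 2 + a1 E * m - a2 E - x"
  have "x * z = - a3 E * m" using chord_relation assms chord z_def by auto
  then have "on_curve E (Affine z (m * z))"
    using z_def by simp Groebner_Basis.algebra
  then show ?thesis
    using add_origin_chord[OF chord(2) refl, of m] chord(1) on_curve_neg_point z_def by metis
qed simp_all

lemma on_curve_multiple_origin: "on_curve E (multiple E n origin)"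
  by (induction n) (simp_all add: multiple_Suc on_curve_add_origin del: add_points.simps)

text \<open>The points \<open>origin\<close>, \<open>P\<close> and \<open>neg_point E Q\<close> below are collinear.\<close>

lemma add_origin_neg_swap:
  assumes "on_curve E P" "a2 E \<noteq> 0"
  shows "add_points E origin (neg_point E (add_points E origin P)) = neg_point E P"
  using assms(1)
proof (cases rule: point_cases)
  case origin
  have "neg_point E (add_points E origin P) = Affine (- a2 E) (0 * (- a2 E))"
    unfolding origin add_origin_origin by simp
  then show ?thesis
    using add_origin_chord[of "- a2 E" 0 0] assms(2) origin by simp
next
  case (chord x m)
  define z where "z = m ^ 2 + a1 E * m - a2 E - x"
  have xz: "x * z = - a3 E * m" using chord_relation assms chord z_def by auto
  have sum: "neg_point E (add_points E origin P) = Affine z (m * z)"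
    unfolding chord(1) add_origin_chord[OF chord(2) refl] z_def by (simp only: neg_neg_point)
  show ?thesis
  proof (cases "z = 0")
    \<comment> \<open>The third intersection is the origin itself, so the line is the tangent there
      and \<open>P\<close> is the negative of the doubled origin.\<close>
    case True
    then have "m = 0" using xz a3 by simp
    then have "x = - a2 E" using True z_def by simp
    then show ?thesis
      unfolding sum using True \<open>m = 0\<close> chord(1) add_origin_origin by simp
  next
    case False
    have "m ^ 2 + a1 E * m - a2 E - z = x" by (simp add: z_def)
    then show ?thesis
      unfolding sum add_origin_chord[OF False refl] by (simp add: chord(1))
  qed
qed simp_all

text \<open>Each induction step moves one copy of \<open>origin\<close> across by
  \<open>add_origin_neg_swap\<close>, which stands in for associativity of the addition.\<close>

lemma multiple_diff_origin:
  assumes "multiple E n origin = Infinity" "a2 E \<noteq> 0" "k \<le> n"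
  shows "multiple E (n - k) origin = neg_point E (multiple E k origin)"
  using \<open>k \<le> n\<close>
proof (induction k)
  case (Suc k)
  define M where "M = multiple E (n - Suc k) origin"
  have "n - k = Suc (n - Suc k)" using Suc.prems by simp
  then have "add_points E origin M = neg_point E (multiple E k origin)"
    using Suc multiple_Suc M_def by (metis Suc_leD)
  then have "add_points E origin (multiple E k origin) = neg_point E M"
    using add_origin_neg_swap[OF _ assms(2), of M] on_curve_multiple_origin M_def
    by (metis neg_neg_point)
  then show ?case unfolding M_def[symmetric] multiple_Suc by (simp only: neg_neg_point)
qed (use assms in simp)

lemma point_has_order_subst:
  assumes "weierstrass_subst u r s t E0 E"
  shows "point_has_order E0 (Affine r t) n \<longleftrightarrow> point_has_order E origin n"
proof -
  have 0: "subst_point u r s t origin = Affine r t" by simp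
  have 1: "multiple E0 k (Affine r t) = subst_point u r s t (multiple E k origin)" for k
  proof (induction k)
    case (Suc k)
    have "add_points E0 (subst_point u r s t origin) (subst_point u r s t (multiple E k origin))
      = subst_point u r s t (add_points E origin (multiple E k origin))"
      by (rule add_points_subst[OF assms _ on_curve_multiple_origin]) simp
    then show ?case unfolding multiple_Suc Suc 0 .
  qed simp
  have "subst_point u r s t P = Infinity \<longleftrightarrow> P = Infinity" for P by (cases P) auto
  then show ?thesis unfolding point_has_order_def 1 by simp
qed

end

context origin_curve
begin

text \<open>If \<open>a2\<close> vanished, the double of the origin would be its negative
  \<open>(0, - a3)\<close>, and the triple would be \<open>Infinity\<close>.\<close>

lemma a2_nonzero_of_order:
  assumes "point_has_order E origin n" "n > 3"
  shows "a2 E \<noteq> 0"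
proof
  assume "a2 E = 0"
  then have "multiple E 3 origin = Infinity"
    by (simp add: multiple_Suc numeral_3_eq_3 a3 del: add_points.simps add: add_points.simps(2))
  then show False using assms by (auto simp: point_has_order_def)
qed

end

section \<open>The Tate normal form of a curve with a point of order 10\<close>

lemma order_10_imp_origin_curve:
  fixes E :: "'a::field weierstrass"
  assumes "on_curve E P" "point_has_order E P 10"
  obtains u r s t E' where "weierstrass_subst u r s t E E'" "origin_curve E'"
    "point_has_order E' (Affine 0 0) 10"
proof -
  have no: "multiple E k P \<noteq> Infinity" if "0 < k" "k < 10" for k
    using assms(2) that by (auto simp: point_has_order_def)
  have "multiple E 1 P = P" by (cases P) (simp_all add: multiple_def)
  then have "P \<noteq> Infinity" using no[of 1] by auto
  then obtain x y where P: "P = Affine x y" by (cases P) auto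
  have d: "y + y + a1 E * x + a3 E \<noteq> 0"
  proof
    assume "y + y + a1 E * x + a3 E = 0"
    then have "multiple E 2 P = Infinity"
      by (simp add: P numeral_2_eq_2 multiple_Suc)
    then show False using no[of 2] by simp
  qed
  \<comment> \<open>The tangent slope at \<open>P\<close>: translating \<open>P\<close> to the
    origin makes \<open>a6\<close> vanish, and shearing by \<open>s\<close> makes the tangent
    horizontal, so that \<open>a4\<close> vanishes.\<close>
  define s where "s = (3 * x ^ 2 + 2 * a2 E * x + a4 E - a1 E * y) / (y + y + a1 E * x + a3 E)"
  have s: "s * (y + y + a1 E * x + a3 E) = 3 * x ^ 2 + 2 * a2 E * x + a4 E - a1 E * y"
    using d by (simp add: s_def)
  define E' where "E' = Weierstrass (a1 E + 2 * s) (a2 E - s * a1 E + 3 * x - s ^ 2)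
    (a3 E + x * a1 E + 2 * y) 0 0"
  have "a4 E - s * a3 E + 2 * x * a2 E - (y + x * s) * a1 E + 3 * x ^ 2 - 2 * s * y = 0"
    using s by Groebner_Basis.algebra
  moreover have "a6 E + x * a4 E + x ^ 2 * a2 E + x ^ 3 - y * a3 E - y ^ 2 - x * y * a1 E = 0"
    using assms(1) unfolding P by simp Groebner_Basis.algebra
  ultimately have sub: "weierstrass_subst 1 x s y E E'"
    by (simp add: weierstrass_subst_def E'_def)
  interpret origin_curve E'
    using d by unfold_locales (simp_all add: E'_def algebra_simps)
  show ?thesis
    using that[OF sub] origin_curve_axioms point_has_order_subst[OF sub] assms(2) P by simp
qed

lemma weierstrass_subst_trans:
  assumes "weierstrass_subst u r s t E E'" "weierstrass_subst v 0 0 0 E' E''"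
  shows "weierstrass_subst (u * v) r s t E E''"
  using assms by (simp add: weierstrass_subst_def power_mult_distrib mult.assoc)

definition tate_curve :: "'a::field \<Rightarrow> 'a \<Rightarrow> 'a weierstrass" where
  "tate_curve b c = Weierstrass (1 - c) (- b) (- b) 0 0"

lemma tate_curve_sel [simp]:
  "a1 (tate_curve b c) = 1 - c" "a2 (tate_curve b c) = - b" "a3 (tate_curve b c) = - b"
  "a4 (tate_curve b c) = 0" "a6 (tate_curve b c) = 0"
  by (simp_all add: tate_curve_def)

lemma order_10_imp_tate_curve:
  fixes E :: "'a::field weierstrass"
  assumes "on_curve E P" "point_has_order E P 10"
  obtains u r s t b c where "weierstrass_subst u r s t E (tate_curve b c)" "b \<noteq> 0"
    "point_has_order (tate_curve b c) (Affine 0 0) 10"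
proof -
  obtain u r s t E' where sub: "weierstrass_subst u r s t E E'" and "origin_curve E'"
    and ord: "point_has_order E' (Affine 0 0) 10"
    using order_10_imp_origin_curve[OF assms] .
  interpret origin_curve E' by fact
  have a2: "a2 E' \<noteq> 0" using a2_nonzero_of_order[OF ord] by simp
  \<comment> \<open>Scaling by \<open>v\<close> divides \<open>a2\<close> by \<open>v ^ 2\<close>
    and \<open>a3\<close> by \<open>v ^ 3\<close>; this \<open>v\<close> makes the results equal,
    with common value \<open>- b\<close>.\<close>
  define v where "v = a3 E' / a2 E'"
  define b where "b = - (a2 E' ^ 3 / a3 E' ^ 2)"
  define c where "c = 1 - a1 E' / v"
  have b: "b \<noteq> 0" using a2 a3 by (simp add: b_def)
  have sub': "weierstrass_subst v 0 0 0 E' (tate_curve b c)"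
    using a2 a3 unfolding weierstrass_subst_def
    by (simp add: v_def b_def c_def power_divide) (simp add: field_simps eval_nat_numeral)
  interpret T: origin_curve "tate_curve b c" using b by unfold_locales simp_all
  show ?thesis
    using that[OF weierstrass_subst_trans[OF sub sub'] b] T.point_has_order_subst[OF sub'] ord by simp
qed

text \<open>The first five multiples are computed in parameters that keep the chord slopes
  polynomial. The condition that the fifth multiple is its own negative is then linear in
  \<open>d\<close>, which yields a rational parametrisation by \<open>f\<close>.\<close>

lemma tate_curve_order_10:
  fixes b c :: "'a::field"
  assumes "b \<noteq> 0" and ord: "point_has_order (tate_curve b c) (Affine 0 0) 10"
  obtains f where "f ^ 2 - 3 * f + 1 \<noteq> 0"
    "c = - (f * (2 * f - 1) * (f - 1) / (f ^ 2 - 3 * f + 1))"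
    "b = f ^ 3 * (2 * f - 1) * (f - 1) / (f ^ 2 - 3 * f + 1) ^ 2"
proof -
  interpret origin_curve "tate_curve b c" using assms(1) by unfold_locales simp_all
  define M where "M k = multiple (tate_curve b c) k origin" for k
  have no: "M k \<noteq> Infinity" if "0 < k" "k < 10" for k
    using ord that by (auto simp: point_has_order_def M_def)
  have M0: "M 0 = Infinity" by (simp add: M_def)
  have MS: "M (Suc k) = add_points (tate_curve b c) origin (M k)" for k
    by (simp add: M_def multiple_Suc)
  have chord: "M (Suc k) = Affine (m ^ 2 + (1 - c) * m + b - x) y'"
    if "M k = Affine x (m * x)" "x \<noteq> 0"
      and "y' = - m * (m ^ 2 + (1 - c) * m + b - x) - (1 - c) * (m ^ 2 + (1 - c) * m + b - x) + b"
    for k x m y'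
    unfolding MS that(1) add_origin_chord[OF that(2) refl] using that(3) by simp
  have M1: "M 1 = origin" using MS[of 0] M0 by simp
  have M2: "M 2 = Affine b (c * b)"
    using MS[of 1] by (simp only: M1 add_origin_origin Suc_1) (simp add: algebra_simps)
  have M3: "M 3 = Affine c (b - c)"
    using chord[OF M2 assms(1), of "b - c"] by (simp add: algebra_simps eval_nat_numeral)
  \<comment> \<open>For \<open>c = 0\<close> the triple is \<open>(0, b)\<close>, the negative of
    the origin.\<close>
  have c: "c \<noteq> 0"
  proof
    assume "c = 0"
    then have "M 4 = Infinity"
      using MS[of 3] add_origin_neg_origin M3 by simp
    then show False using no[of 4] by simp
  qed
  \<comment> \<open>The chord from the origin to the triple \<open>(c, b - c)\<close> has slope
    \<open>d - 1\<close>.\<close>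
  define d where "d = b / c"
  have bd: "b = c * d" using c by (simp add: d_def)
  have d: "d \<noteq> 0" using assms(1) bd by auto
  have M3': "M 3 = Affine c ((d - 1) * c)" by (simp add: M3 bd algebra_simps)
  have M4: "M 4 = Affine (d * (d - 1)) (d ^ 2 * (c - d + 1))"
  proof -
    have "(d - 1) ^ 2 + (1 - c) * (d - 1) + b - c = d * (d - 1)"
      unfolding bd by Groebner_Basis.algebra
    moreover have "d ^ 2 * (c - d + 1) = - (d - 1) * (d * (d - 1)) - (1 - c) * (d * (d - 1)) + b"
      unfolding bd by Groebner_Basis.algebra
    ultimately show ?thesis using chord[OF M3' c] by simp
  qed
  have d1: "d \<noteq> 1"
  proof
    assume "d = 1"
    then have "M 5 = Infinity"
      using MS[of 4] M4 bd add_origin_neg_origin by simp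
    then show False using no[of 5] by simp
  qed
  \<comment> \<open>Chosen so that the chord from the origin to the fourth multiple has slope
    \<open>d * (f - 1)\<close>.\<close>
  define f where "f = c / (d - 1)"
  have cf: "c = f * (d - 1)" using d1 by (simp add: f_def)
  have M4': "M 4 = Affine (d * (d - 1)) (d * (f - 1) * (d * (d - 1)))"
    unfolding M4 cf by (simp add: algebra_simps eval_nat_numeral)
  define y where "y = - (d * (f - 1)) * (d * f * (f - 1)) - (1 - c) * (d * f * (f - 1)) + b"
  have M5: "M 5 = Affine (d * f * (f - 1)) y"
  proof -
    have "(d * (f - 1)) ^ 2 + (1 - c) * (d * (f - 1)) + b - d * (d - 1) = d * f * (f - 1)"
      unfolding bd cf by Groebner_Basis.algebra
    then show ?thesis using chord[OF M4'] d d1 by (simp add: y_def)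
  qed
  \<comment> \<open>The tenth multiple enters only as
    \<open>M 5 = neg_point (tate_curve b c) (M 5)\<close>, an equation between ordinates.\<close>
  have "M 10 = Infinity" using ord by (simp add: point_has_order_def M_def)
  then have "M (10 - 5) = neg_point (tate_curve b c) (M 5)"
    unfolding M_def by (rule multiple_diff_origin[where n = 10 and k = 5]) (use assms(1) in simp_all)
  then have "2 * y + (1 - c) * (d * f * (f - 1)) - b = 0"
    by (simp add: M5 algebra_simps)
  moreover have "2 * y + (1 - c) * (d * f * (f - 1)) - b = - (d * f * (d * (f ^ 2 - 3 * f + 1) + f ^ 2))"
    unfolding y_def bd cf by Groebner_Basis.algebra
  ultimately have "d * f * (d * (f ^ 2 - 3 * f + 1) + f ^ 2) = 0" by simp
  moreover have f: "f \<noteq> 0" using c cf by auto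
  ultimately have eq: "d * (f ^ 2 - 3 * f + 1) = - (f ^ 2)"
    using d by (simp add: eq_neg_iff_add_eq_0)
  then have nz: "f ^ 2 - 3 * f + 1 \<noteq> 0" using f by auto
  have c1: "c * (f ^ 2 - 3 * f + 1) = - (f * (2 * f - 1) * (f - 1))"
  proof -
    have "c * (f ^ 2 - 3 * f + 1) = f * (d * (f ^ 2 - 3 * f + 1) - (f ^ 2 - 3 * f + 1))"
      unfolding cf by Groebner_Basis.algebra
    then show ?thesis unfolding eq by Groebner_Basis.algebra
  qed
  have b1: "b * (f ^ 2 - 3 * f + 1) ^ 2 = f ^ 3 * (2 * f - 1) * (f - 1)"
  proof -
    have "b * (f ^ 2 - 3 * f + 1) ^ 2 = (c * (f ^ 2 - 3 * f + 1)) * (d * (f ^ 2 - 3 * f + 1))"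
      unfolding bd by Groebner_Basis.algebra
    then show ?thesis unfolding eq c1 by Groebner_Basis.algebra
  qed
  show ?thesis
  proof (rule that[OF nz])
    show "c = - (f * (2 * f - 1) * (f - 1) / (f ^ 2 - 3 * f + 1))"
      unfolding minus_divide_left nonzero_eq_divide_eq[OF nz] by (rule c1)
    show "b = f ^ 3 * (2 * f - 1) * (f - 1) / (f ^ 2 - 3 * f + 1) ^ 2"
      using b1 nz by (simp add: nonzero_eq_divide_eq)
  qed
qed

section \<open>An integral model with two coprime parameters\<close>

definition q1 :: "'a::comm_ring_1 \<Rightarrow> 'a \<Rightarrow> 'a" where
  "q1 m n = m ^ 2 - 3 * m * n + n ^ 2"

text \<open>While \<open>q1\<close> is the homogenised denominator \<open>f ^ 2 - 3 * f + 1\<close>,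
  this form is the remaining quadratic factor of the discriminant. The two have discriminants 5 and
  20, so the prime 5 needs separate treatment later.\<close>

definition q2 :: "'a::comm_ring_1 \<Rightarrow> 'a \<Rightarrow> 'a" where
  "q2 m n = 4 * m ^ 2 - 2 * m * n - n ^ 2"

text \<open>The Tate curve at \<open>f = m / n\<close>, rescaled by \<open>n * q1 m n\<close> to
  clear the denominators of \<open>b\<close> and \<open>c\<close>.\<close>

definition order_10_model :: "'a::comm_ring_1 \<Rightarrow> 'a \<Rightarrow> 'a weierstrass" where
  "order_10_model m n = Weierstrass
     (n * q1 m n + m * (2 * m - n) * (m - n))
     (- (n * m ^ 3 * (2 * m - n) * (m - n)))
     (- (n ^ 2 * q1 m n * m ^ 3 * (2 * m - n) * (m - n))) 0 0"

lemma order_10_model_sel [simp]: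
  "a1 (order_10_model m n) = n * q1 m n + m * (2 * m - n) * (m - n)"
  "a2 (order_10_model m n) = - (n * m ^ 3 * (2 * m - n) * (m - n))"
  "a3 (order_10_model m n) = - (n ^ 2 * q1 m n * m ^ 3 * (2 * m - n) * (m - n))"
  "a4 (order_10_model m n) = 0" "a6 (order_10_model m n) = 0"
  by (simp_all add: order_10_model_def)

lemma map_order_10_model:
  "map_weierstrass of_int (order_10_model m n) = order_10_model (of_int m) (of_int n)"
  by (simp add: order_10_model_def q1_def)

lemma disc_order_10_model:
  fixes m n :: int
  shows "disc (order_10_model m n) =
    m ^ 10 * (m - n) ^ 10 * n ^ 5 * (2 * m - n) ^ 5 * q1 m n ^ 2 * q2 m n"
proof -
  \<comment> \<open>Since \<open>a3 = w * a2\<close>, the discriminant contains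
    \<open>w ^ 2 * B ^ 3\<close>; only a cofactor of degree 12 in \<open>m\<close> and
    \<open>n\<close> remains to be factored.\<close>
  define w where "w = n * q1 m n"
  define B where "B = - (n * m ^ 3 * (2 * m - n) * (m - n))"
  define a where "a = n * q1 m n + m * (2 * m - n) * (m - n)"
  have a3: "a3 (order_10_model m n) = w * B"
    unfolding order_10_model_sel w_def B_def by Groebner_Basis.algebra
  have a12: "a1 (order_10_model m n) = a" "a2 (order_10_model m n) = B"
    by (simp_all add: a_def B_def)
  have "disc (order_10_model m n) =
    w ^ 2 * B ^ 3 * (- ((a ^ 2 + 4 * B) ^ 2) - 8 * a ^ 3 * w - 27 * w ^ 2 * B + 9 * (a ^ 2 + 4 * B) * a * w)"
    unfolding disc_def b2_def b4_def b6_def b8_def a3 a12 order_10_model_sel(4,5)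
    by (simp add: algebra_simps eval_nat_numeral)
  moreover have "- ((a ^ 2 + 4 * B) ^ 2) - 8 * a ^ 3 * w - 27 * w ^ 2 * B + 9 * (a ^ 2 + 4 * B) * a * w
    = - (m * (m - n) ^ 7 * (2 * m - n) ^ 2 * q2 m n)"
    unfolding a_def B_def w_def q1_def q2_def by Groebner_Basis.algebra
  ultimately show ?thesis unfolding w_def B_def by Groebner_Basis.algebra
qed

lemma tate_curve_subst_order_10_model:
  fixes m n :: rat
  assumes n: "n \<noteq> 0" and q: "q1 m n \<noteq> 0"
    and f: "f = m / n" and c: "c = - (f * (2 * f - 1) * (f - 1) / (f ^ 2 - 3 * f + 1))"
    and b: "b = f ^ 3 * (2 * f - 1) * (f - 1) / (f ^ 2 - 3 * f + 1) ^ 2"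
  shows "weierstrass_subst (1 / (n * q1 m n)) 0 0 0 (tate_curve b c) (order_10_model m n)"
proof -
  define v where "v = n * q1 m n"
  have v: "v \<noteq> 0" using n q by (simp add: v_def)
  have "f ^ 2 - 3 * f + 1 = q1 m n / n ^ 2"
    using n by (simp add: q1_def f field_simps power2_eq_square)
  then have den: "f ^ 2 - 3 * f + 1 = v / n ^ 3"
    using n by (simp add: v_def eval_nat_numeral)
  have c': "v * c = - (m * (2 * m - n) * (m - n))"
    using n v unfolding c den unfolding f by (simp add: field_simps eval_nat_numeral)
  have b': "v ^ 2 * b = n * m ^ 3 * (2 * m - n) * (m - n)"
    using n v unfolding b den unfolding f by (simp add: field_simps eval_nat_numeral)
  have "a1 (order_10_model m n) = v * (1 - c)"
    using c' by (simp add: v_def algebra_simps)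
  moreover have "a2 (order_10_model m n) = v ^ 2 * - b"
    using b' by simp
  moreover have "a3 (order_10_model m n) = v ^ 3 * - b"
    using b' unfolding order_10_model_sel v_def by Groebner_Basis.algebra
  ultimately show ?thesis
    unfolding weierstrass_subst_def v_def[symmetric] using v by (simp add: power_divide)
qed

lemma order_10_imp_model:
  fixes E :: "rat weierstrass"
  assumes "elliptic_curve E" "on_curve E P" "point_has_order E P 10"
  obtains m n :: int where "coprime m n" "disc (order_10_model m n) \<noteq> 0"
    "weierstrass_iso E (map_weierstrass of_int (order_10_model m n))"
proof -
  obtain u r s t b c where sub: "weierstrass_subst u r s t E (tate_curve b c)" and "b \<noteq> 0"
    "point_has_order (tate_curve b c) (Affine 0 0) 10"
    using order_10_imp_tate_curve[OF assms(2,3)] .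
  then obtain f where nz: "f ^ 2 - 3 * f + 1 \<noteq> 0"
    and c: "c = - (f * (2 * f - 1) * (f - 1) / (f ^ 2 - 3 * f + 1))"
    and b: "b = f ^ 3 * (2 * f - 1) * (f - 1) / (f ^ 2 - 3 * f + 1) ^ 2"
    using tate_curve_order_10 by blast
  \<comment> \<open>The parameter in lowest terms supplies the coprime pair.\<close>
  obtain m n where mn: "quotient_of f = (m, n)" by (cases "quotient_of f")
  then have f: "f = of_int m / of_int n" and cop: "coprime m n" and n: "n > 0"
    by (simp_all add: quotient_of_div quotient_of_coprime quotient_of_denom_pos)
  have "f ^ 2 - 3 * f + 1 = q1 (of_int m) (of_int n) / of_int n ^ 2"
    using n by (simp add: q1_def f field_simps power2_eq_square)
  then have q: "q1 (of_int m) (of_int n) \<noteq> (0 :: rat)" using nz by auto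
  define W where "W = order_10_model m n"
  have "weierstrass_subst (1 / (of_int n * q1 (of_int m) (of_int n))) 0 0 0 (tate_curve b c)
    (map_weierstrass of_int W)"
    unfolding W_def map_order_10_model
    by (rule tate_curve_subst_order_10_model[OF _ q f c b]) (use n in simp)
  from weierstrass_subst_trans[OF sub this]
  obtain u' where sub': "weierstrass_subst u' r s t E (map_weierstrass of_int W)" by blast
  have "disc (map_weierstrass of_int W) \<noteq> (0 :: rat)"
    using disc_subst[OF sub'] assms(1) by (auto simp: elliptic_curve_def)
  moreover have "disc (map_weierstrass of_int W) = (of_int (disc W) :: rat)"
    by (simp add: disc_def b2_def b4_def b6_def b8_def weierstrass.map_sel)
  ultimately show ?thesis
    using that[OF cop] sub' weierstrass_iso_iff_subst W_def by fastforce
qed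

section \<open>Bad primes and the conductor\<close>

text \<open>Here \<open>a / b\<close> is the scaling between two models. As \<open>p\<close> divides
  \<open>D\<close> but not \<open>D0\<close>, it divides \<open>a\<close>, so its valuation in
  \<open>D\<close> is 12 times that in \<open>a\<close>, and in \<open>C\<close> at least 4 times.
  Thirteen factors in \<open>D\<close> thus force \<open>p ^ 2\<close> to divide
  \<open>a\<close>.\<close>

lemma scaled_invariants_dvd:
  fixes a b D D0 C C0 p :: int
  assumes D: "D * b ^ 12 = D0 * a ^ 12" and C: "C * b ^ 4 = C0 * a ^ 4"
    and "coprime a b" "prime p" "\<not> p dvd D0" "p dvd D"
  shows "p ^ 12 dvd D" "p ^ 4 dvd C" "p ^ 13 dvd D \<Longrightarrow> p ^ 8 dvd C"
proof -
  have "p dvd D0 * a ^ 12" unfolding D[symmetric] using \<open>p dvd D\<close> by simp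
  then have "p dvd a" using assms(4,5) prime_dvd_mult_iff prime_dvd_power by metis
  then have "\<not> p dvd b" using assms(3,4) by (meson coprime_common_divisor not_prime_unit)
  then have "coprime p b" using assms(4) by (simp add: prime_imp_coprime)
  then have cop: "coprime (p ^ i) (b ^ j)" for i j by simp
  obtain a' where a: "a = p * a'" using \<open>p dvd a\<close> by blast
  have "p ^ 12 dvd D * b ^ 12" unfolding D a power_mult_distrib by simp
  then show "p ^ 12 dvd D" using cop coprime_dvd_mult_left_iff by blast
  have "p ^ 4 dvd C * b ^ 4" unfolding C a power_mult_distrib by simp
  then show "p ^ 4 dvd C" using cop coprime_dvd_mult_left_iff by blast
  assume "p ^ 13 dvd D"
  then have "p ^ 13 dvd D * b ^ 12" by simp
  then have "p ^ 12 * p dvd p ^ 12 * (D0 * a' ^ 12)"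
    unfolding D a by (simp add: power_mult_distrib mult_ac flip: power_Suc)
  then have "p dvd D0 * a' ^ 12" using assms(4) by (subst (asm) dvd_mult_cancel_left) auto
  then have "p dvd a'" using assms(4,5) prime_dvd_mult_iff prime_dvd_power by metis
  then obtain a'' where "a' = p * a''" by blast
  then have "C * b ^ 4 = p ^ 8 * (C0 * a'' ^ 4)"
    unfolding C a by (simp add: algebra_simps eval_nat_numeral)
  then have "p ^ 8 dvd C * b ^ 4" by simp
  then show "p ^ 8 dvd C" using cop coprime_dvd_mult_left_iff by blast
qed

text \<open>Used contrapositively as a test for bad primes on a model not known to be minimal. The
  ratio \<open>u0 / u\<close> of the scalings to \<open>W\<close> and to a model with discriminant
  prime to \<open>p\<close> plays the part of \<open>a / b\<close> above.\<close>

lemma good_reduction_dvd: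
  assumes iso: "weierstrass_iso E (map_weierstrass of_int W)" and "good_reduction E p"
    and "prime p" "int p dvd disc W"
  shows "int p ^ 12 dvd disc W" "int p ^ 4 dvd c4 W" "int p ^ 13 dvd disc W \<Longrightarrow> int p ^ 8 dvd c4 W"
proof -
  obtain W0 where iso0: "weierstrass_iso E (map_weierstrass of_int W0)" and p: "\<not> int p dvd disc W0"
    using assms(2) by (auto simp: good_reduction_def minimal_model_at_def)
  have map: "disc (map_weierstrass of_int V) = (of_int (disc V) :: rat)"
    "c4 (map_weierstrass of_int V) = (of_int (c4 V) :: rat)" for V
    by (simp_all add: disc_def c4_def b2_def b4_def b6_def b8_def weierstrass.map_sel)
  obtain u r s t where sub: "weierstrass_subst u r s t E (map_weierstrass of_int W)"
    using iso weierstrass_iso_iff_subst by blast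
  obtain u0 r0 s0 t0 where sub0: "weierstrass_subst u0 r0 s0 t0 E (map_weierstrass of_int W0)"
    using iso0 weierstrass_iso_iff_subst by blast
  have u: "u \<noteq> 0" using sub by (simp add: weierstrass_subst_def)
  obtain a b where "quotient_of (u0 / u) = (a, b)" by (cases "quotient_of (u0 / u)")
  then have ab: "u0 / u = of_int a / of_int b" and cop: "coprime a b" and b: "b > 0"
    by (simp_all add: quotient_of_div quotient_of_coprime quotient_of_denom_pos)
  have uab: "u0 * of_int b = u * of_int a" using ab u b by (simp add: field_simps)
  have "u ^ k * of_int (x * b ^ k) = u ^ k * of_int (y * a ^ k)"
    if "u ^ k * of_int x = u0 ^ k * (of_int y :: rat)" for k x y
  proof -
    have "u ^ k * of_int (x * b ^ k) = of_int y * (u0 * of_int b) ^ k"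
      using that by (simp add: power_mult_distrib mult_ac)
    then show ?thesis unfolding uab by (simp add: power_mult_distrib mult_ac)
  qed
  then have scale: "x * b ^ k = y * a ^ k"
    if "u ^ k * of_int x = u0 ^ k * (of_int y :: rat)" for k x y
    using that u by (metis mult_left_cancel of_int_eq_iff power_not_zero)
  have D: "disc W * b ^ 12 = disc W0 * a ^ 12"
    by (rule scale) (use disc_subst[OF sub] disc_subst[OF sub0] in \<open>simp add: map\<close>)
  have C: "c4 W * b ^ 4 = c4 W0 * a ^ 4"
    by (rule scale) (use c4_subst[OF sub] c4_subst[OF sub0] in \<open>simp add: map\<close>)
  show "int p ^ 12 dvd disc W" "int p ^ 4 dvd c4 W" "int p ^ 13 dvd disc W \<Longrightarrow> int p ^ 8 dvd c4 W"
    using scaled_invariants_dvd[OF D C cop _ p] assms(3,4) by simp_all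
qed

text \<open>A product over an infinite set is 1 by convention, so a conductor other than 1
  guarantees finitely many factors. Bad primes have exponent 1 or at least 2.\<close>

lemma prime_dvd_conductor_iff:
  assumes "conductor E \<noteq> 1" "prime p"
  shows "p dvd conductor E \<longleftrightarrow> \<not> good_reduction E p"
proof -
  define S where "S = {p. prime p \<and> conductor_exponent E p \<noteq> 0}"
  have c: "conductor E = (\<Prod>p\<in>S. p ^ conductor_exponent E p)"
    by (simp add: conductor_def S_def)
  then have fin: "finite S" using assms(1) by (metis prod.infinite)
  have "p dvd conductor E \<longleftrightarrow> (\<exists>r\<in>S. p dvd r ^ conductor_exponent E r)"
    unfolding c using fin assms(2) by (simp add: prime_dvd_prod_iff)
  also have "\<dots> \<longleftrightarrow> p \<in> S"
  proof
    assume "\<exists>r\<in>S. p dvd r ^ conductor_exponent E r"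
    then obtain r where r: "r \<in> S" "p dvd r ^ conductor_exponent E r" by blast
    then have "p dvd r" using assms(2) prime_dvd_power by blast
    then show "p \<in> S" using r assms(2) primes_dvd_imp_eq by (auto simp: S_def)
  next
    assume "p \<in> S"
    then show "\<exists>r\<in>S. p dvd r ^ conductor_exponent E r"
      by (intro bexI[of _ p]) (auto simp: S_def)
  qed
  also have "\<dots> \<longleftrightarrow> \<not> good_reduction E p"
    using assms(2) by (auto simp: S_def conductor_exponent_def)
  finally show ?thesis .
qed

lemma prime_power_product_dvd:
  fixes p q :: nat
  assumes "conductor E = p ^ \<alpha> * q ^ \<beta>" "prime p" "prime q" "\<alpha> > 0" "prime r" "\<not> good_reduction E r"
  shows "r = p \<or> r = q"
proof -
  have "p dvd conductor E" using assms(1,4) by (simp add: dvd_power)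
  then have "conductor E \<noteq> 1" using assms(2) by (metis not_prime_unit)
  then have "r dvd p ^ \<alpha> * q ^ \<beta>" using prime_dvd_conductor_iff assms by metis
  then have "r dvd p \<or> r dvd q" using assms(5) prime_dvd_mult_iff prime_dvd_power by blast
  then show ?thesis using assms primes_dvd_imp_eq by blast
qed

lemma odd_prime_divisor:
  fixes x :: int
  assumes "odd x" "\<bar>x\<bar> \<noteq> 1"
  obtains p :: nat where "prime p" "p \<noteq> 2" "int p dvd x"
proof -
  have "nat \<bar>x\<bar> \<noteq> 1" using assms(2) by simp
  then obtain p where p: "prime p" "p dvd nat \<bar>x\<bar>" using prime_factor_nat by blast
  then have "int p dvd x" by (simp add: nat_abs_dvd_iff flip: int_dvd_int_iff)
  moreover have "p \<noteq> 2" using calculation assms(1) by auto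
  ultimately show ?thesis using that p by blast
qed

section \<open>Prime divisors of the discriminant\<close>

lemma not_five_mult_unit: "\<bar>5 * k\<bar> \<noteq> (1 :: int)"
  by presburger

lemma not_dvd_4:
  assumes "prime p" "p \<noteq> (2 :: int)"
  shows "\<not> p dvd 4"
proof
  assume "p dvd 4"
  then have "p dvd 2 ^ 2" by simp
  then have "p dvd 2" using assms(1) prime_dvd_power by blast
  then show False using assms primes_dvd_imp_eq[of p 2] by simp
qed

locale coprime_pair =
  fixes m n :: int
  assumes coprime: "coprime m n"
begin

text \<open>It vanishes at the rational cusps, where \<open>m / n\<close> is 0, infinity, 1 or
  1/2.\<close>

abbreviation "cusp_product \<equiv> m * n * (m - n) * (2 * m - n)"

abbreviation "W \<equiv> order_10_model m n"

lemma prime_not_dvd_both: "\<not> (p dvd m \<and> p dvd n)" if "prime p"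
  using coprime that by (meson coprime_common_divisor not_prime_unit)

lemma prime_dvd_cusp_product_cases [consumes 2]:
  assumes "prime p" "p dvd cusp_product"
  obtains "p dvd m" | "p dvd n" | "p dvd m - n" | "p dvd 2 * m - n"
  using assms by (auto simp: prime_dvd_mult_iff)

text \<open>Modulo each of the four linear factors, \<open>q1 m n\<close> is plus or minus the
  square of \<open>m\<close> or \<open>n\<close>, and a common prime would divide both.\<close>

lemma prime_dvd_cusp_product_not_dvd_q1:
  assumes p: "prime p" and "p dvd cusp_product"
  shows "\<not> p dvd q1 m n"
proof
  assume q: "p dvd q1 m n"
  have eqs: "n ^ 2 = q1 m n - m * (m - 3 * n)" "m ^ 2 = q1 m n - n * (n - 3 * m)"
    "n ^ 2 = (m - n) * (m - 2 * n) - q1 m n" "m ^ 2 = (2 * m - n) * (m - n) - q1 m n"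
    unfolding q1_def by Groebner_Basis.algebra+
  from assms show False
  proof (cases rule: prime_dvd_cusp_product_cases)
    case 1
    then have "p dvd n ^ 2" unfolding eqs(1) using q by simp
    then show False using 1 p prime_not_dvd_both prime_dvd_power by blast
  next
    case 2
    then have "p dvd m ^ 2" unfolding eqs(2) using q by simp
    then show False using 2 p prime_not_dvd_both prime_dvd_power by blast
  next
    case 3
    then have "p dvd n ^ 2" unfolding eqs(3) using q by simp
    then have "p dvd n" using p prime_dvd_power by blast
    then have "p dvd m" using dvd_add[OF 3, of n] by simp
    then show False using \<open>p dvd n\<close> p prime_not_dvd_both by blast
  next
    case 4
    then have "p dvd m ^ 2" unfolding eqs(4) using q by simp
    then have "p dvd m" using p prime_dvd_power by blast
    then have "p dvd n" using dvd_diff[of p "2 * m" "2 * m - n"] 4 by simp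
    then show False using \<open>p dvd m\<close> p prime_not_dvd_both by blast
  qed
qed

text \<open>As for \<open>q1\<close>, except that two of the residues are \<open>4 * m ^ 2\<close>
  up to sign, whence the exclusion of 2.\<close>

lemma prime_dvd_cusp_product_not_dvd_q2:
  assumes p: "prime p" "p \<noteq> 2" and "p dvd cusp_product"
  shows "\<not> p dvd q2 m n"
proof
  assume q: "p dvd q2 m n"
  have eqs: "n ^ 2 = m * (4 * m - 2 * n) - q2 m n" "4 * m ^ 2 = q2 m n + n * (2 * m + n)"
    "n ^ 2 = q2 m n - (m - n) * (4 * m + 2 * n)" "4 * m ^ 2 = (2 * m - n) * (n + 4 * m) - q2 m n"
    unfolding q2_def by Groebner_Basis.algebra+
  from p(1) assms(3) show False
  proof (cases rule: prime_dvd_cusp_product_cases)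
    case 1
    then have "p dvd n ^ 2" unfolding eqs(1) using q by simp
    then show False using 1 p prime_not_dvd_both prime_dvd_power by blast
  next
    case 2
    then have "p dvd 4 * m ^ 2" unfolding eqs(2) using q by simp
    then have "p dvd m" using p prime_dvd_power not_dvd_4 prime_dvd_mult_iff by metis
    then show False using 2 p prime_not_dvd_both by blast
  next
    case 3
    then have "p dvd n ^ 2" unfolding eqs(3) using q by simp
    then have "p dvd n" using p prime_dvd_power by blast
    then have "p dvd m" using dvd_add[OF 3, of n] by simp
    then show False using \<open>p dvd n\<close> p prime_not_dvd_both by blast
  next
    case 4
    then have "p dvd 4 * m ^ 2" unfolding eqs(4) using q by simp
    then have "p dvd m" using p prime_dvd_power not_dvd_4 prime_dvd_mult_iff by metis
    then have "p dvd n" using dvd_diff[of p "2 * m" "2 * m - n"] 4 by simp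
    then show False using \<open>p dvd m\<close> p prime_not_dvd_both by blast
  qed
qed

text \<open>Such a prime divides \<open>a2\<close> and \<open>a3\<close>, so \<open>c4\<close> is
  congruent to \<open>a1 ^ 4\<close>. Modulo \<open>p\<close>, \<open>a1\<close> is
  \<open>2 * m ^ 3\<close> if \<open>p\<close> divides \<open>n\<close> and
  \<open>n * q1 m n\<close> otherwise.\<close>

lemma prime_dvd_cusp_product_not_dvd_c4:
  assumes p: "prime p" "p \<noteq> 2 \<or> odd n" and K: "p dvd cusp_product"
  shows "\<not> p dvd c4 W"
proof
  assume "p dvd c4 W"
  have q: "\<not> p dvd q1 m n" using prime_dvd_cusp_product_not_dvd_q1 p(1) K .
  have a2: "a2 W = - (cusp_product * m ^ 2)" "a3 W = - (cusp_product * (m ^ 2 * n * q1 m n))"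
    unfolding order_10_model_sel by Groebner_Basis.algebra+
  have "p dvd a2 W" "p dvd a3 W" unfolding a2 using K by simp_all
  have "c4 W = a1 W ^ 4 + a2 W * (8 * a1 W ^ 2 + 16 * a2 W) - a3 W * (24 * a1 W)"
    unfolding c4_def b2_def b4_def order_10_model_sel(4) by Groebner_Basis.algebra
  then have "a1 W ^ 4 = c4 W - a2 W * (8 * a1 W ^ 2 + 16 * a2 W) + a3 W * (24 * a1 W)" by simp
  then have "p dvd a1 W ^ 4"
    using \<open>p dvd c4 W\<close> \<open>p dvd a2 W\<close> \<open>p dvd a3 W\<close> by simp
  then have a1: "p dvd n * q1 m n + m * (2 * m - n) * (m - n)"
    using p(1) prime_dvd_power unfolding order_10_model_sel by blast
  show False
  proof (cases "p dvd n")
    case True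
    then have "p \<noteq> 2" using p(2) by auto
    have "2 * m ^ 3 = (n * q1 m n + m * (2 * m - n) * (m - n)) - n * (q1 m n + m * (n - 3 * m))"
      by Groebner_Basis.algebra
    then have "p dvd 2 * m ^ 3" using a1 True by simp
    moreover have "\<not> p dvd 2" using \<open>p \<noteq> 2\<close> p(1) primes_dvd_imp_eq[of p 2] by auto
    ultimately have "p dvd m" using p(1) prime_dvd_power prime_dvd_mult_iff by metis
    then show False using True p(1) prime_not_dvd_both by blast
  next
    case False
    then have "p dvd m * (2 * m - n) * (m - n)"
      using K p(1) by (auto simp: prime_dvd_mult_iff)
    then have "p dvd n * q1 m n" using a1 dvd_add_left_iff by blast
    then show False using False q p(1) prime_dvd_mult_iff by blast
  qed
qed

lemma prime_dvd_q1_and_c4: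
  assumes p: "prime p" and q: "p dvd q1 m n" and "p dvd c4 W"
  shows "p = 5"
proof -
  have K: "\<not> p dvd cusp_product" using prime_dvd_cusp_product_not_dvd_q1 p q by blast
  define l where "l = m * (2 * m - n) * (m - n)"
  have a1: "a1 W = n * q1 m n + l" by (simp add: l_def)
  have a2: "a2 W = - (n * m ^ 2 * l)" unfolding l_def order_10_model_sel by Groebner_Basis.algebra
  have a3: "a3 W = - (n ^ 2 * q1 m n * m ^ 2 * l)" unfolding l_def order_10_model_sel by Groebner_Basis.algebra
  \<comment> \<open>Modulo \<open>q1 m n\<close>, \<open>a1\<close> reduces to \<open>l\<close> and
    \<open>a3\<close> to 0, so \<open>c4\<close> becomes the square of the reduced
    \<open>b2\<close>.\<close>
  have "(l ^ 2 - 4 * n * m ^ 2 * l) ^ 2 = c4 W - q1 m n *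
    (n * (n * q1 m n + 2 * l) * (2 * (l ^ 2 - 4 * n * m ^ 2 * l) + n * (n * q1 m n + 2 * l) * q1 m n)
     + 24 * (n * q1 m n + l) * n ^ 2 * m ^ 2 * l)"
    unfolding c4_def b2_def b4_def order_10_model_sel(4) a1 a2 a3 by Groebner_Basis.algebra
  then have "p dvd (l ^ 2 - 4 * n * m ^ 2 * l) ^ 2" using q \<open>p dvd c4 W\<close> by simp
  then have "p dvd l ^ 2 - 4 * n * m ^ 2 * l" using p prime_dvd_power by blast
  \<comment> \<open>Modulo \<open>q1 m n\<close>, \<open>l\<close> is \<open>m ^ 3\<close> and
    \<open>m * (m - 4 * n)\<close> is \<open>- n * (m + n)\<close>.\<close>
  moreover have "m ^ 2 * n * (m + n) * l = q1 m n * (2 * m ^ 2 * l) - m * (l ^ 2 - 4 * n * m ^ 2 * l)"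
    unfolding l_def q1_def by Groebner_Basis.algebra
  ultimately have "p dvd m ^ 2 * n * (m + n) * l" using q by simp
  then have "p dvd m + n" using K p unfolding l_def by (auto simp: prime_dvd_mult_iff prime_dvd_power_iff)
  moreover have "5 * m ^ 2 = q1 m n - (m + n) * (n - 4 * m)"
    unfolding q1_def by Groebner_Basis.algebra
  ultimately have "p dvd 5 * m ^ 2" using q by simp
  then have "p dvd 5" using K p by (auto simp: prime_dvd_mult_iff prime_dvd_power_iff)
  then show ?thesis using p primes_dvd_imp_eq[of p 5] by simp
qed

lemma prime_dvd_q2_and_c4:
  assumes p: "prime p" "p \<noteq> 2" and q: "p dvd q2 m n" and "p dvd c4 W"
  shows "p = 5"
proof (rule ccontr)
  assume "p \<noteq> 5"
  have K: "\<not> p dvd cusp_product" using prime_dvd_cusp_product_not_dvd_q2 p q by blast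
  text \<open>Polynomial division of \<open>c4\<close> by \<open>q2\<close>; the linear factor is a unit multiple of \<open>n\<close> modulo
    \<open>q2\<close>, as \<open>1597\<close> and \<open>1292\<close> come from a power of the fundamental unit of \<open>\<rat>(\<surd>5)\<close>.\<close>
  have "80 * m ^ 11 * (1597 * m - 1292 * n) = c4 W + q2 m n *
    (31936 * m ^ 10 - 9840 * m ^ 9 * n + 2960 * m ^ 8 * n ^ 2 - 800 * m ^ 7 * n ^ 3
     + 160 * m ^ 6 * n ^ 4 - 48 * m ^ 5 * n ^ 5 + 80 * m ^ 4 * n ^ 6 - 80 * m ^ 3 * n ^ 7
     + 40 * m ^ 2 * n ^ 8 - 10 * m * n ^ 9 + n ^ 10)"
    unfolding c4_def b2_def b4_def order_10_model_sel q1_def q2_def by Groebner_Basis.algebra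
  then have "p dvd 80 * m ^ 11 * (1597 * m - 1292 * n)"
    using q \<open>p dvd c4 W\<close> by simp
  moreover have "\<not> p dvd 80"
  proof
    assume "p dvd 80"
    then have "p dvd 2 ^ 4 * 5" by simp
    then have "p dvd 2 \<or> p dvd 5" using p(1) prime_dvd_mult_iff prime_dvd_power by blast
    then show False using p \<open>p \<noteq> 5\<close> primes_dvd_imp_eq[of p 2] primes_dvd_imp_eq[of p 5] by auto
  qed
  ultimately have d: "p dvd 1597 * m - 1292 * n"
    using K p(1) by (auto simp: prime_dvd_mult_iff prime_dvd_power_iff)
  \<comment> \<open>1597 and 2 * 1292 are consecutive Fibonacci numbers with
    \<open>4 * 1292 ^ 2 - 2 * 1292 * 1597 - 1597 ^ 2 = -1\<close>, so eliminating \<open>m\<close>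
    leaves exactly \<open>n ^ 2\<close>.\<close>
  have "n ^ 2 = (1597 * m - 1292 * n) * (4 * (1597 * m + 1292 * n) - 2 * 1597 * n) - 1597 ^ 2 * q2 m n"
    unfolding q2_def by (simp add: algebra_simps power2_eq_square)
  then have "p dvd n ^ 2" using d q by simp
  then have "p dvd n" using p(1) prime_dvd_power by blast
  then show False using K by simp
qed

text \<open>Modulo 5 both forms are plus or minus \<open>(m + n) ^ 2\<close>. If 5 divides one of
  them, it divides each exactly once, so the discriminant has valuation 2 + 1 = 3.\<close>

lemma five_power_not_dvd_disc:
  assumes "5 dvd q1 m n * q2 m n"
  shows "\<not> 5 ^ 12 dvd disc W"
proof
  assume d: "5 ^ 12 dvd disc W"
  have p5: "prime (5 :: int)" by simp
  have "5 dvd q1 m n \<or> 5 dvd q2 m n" using assms p5 prime_dvd_mult_iff by blast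
  then have K: "\<not> 5 dvd cusp_product"
    using prime_dvd_cusp_product_not_dvd_q1[OF p5] prime_dvd_cusp_product_not_dvd_q2[OF p5] by auto
  have eqs: "q1 m n = (m + n) ^ 2 - 5 * (m * n)" "q2 m n = 5 * m ^ 2 - (m + n) ^ 2"
    unfolding q1_def q2_def by Groebner_Basis.algebra+
  have "5 dvd (m + n) ^ 2" using \<open>5 dvd q1 m n \<or> 5 dvd q2 m n\<close> unfolding eqs
    by (metis dvd_add_right_iff dvd_triv_left diff_add_cancel dvd_diff_right_iff)
  then have "5 dvd m + n" using p5 prime_dvd_power by blast
  then obtain k where k: "m + n = 5 * k" by blast
  have x: "q1 m n = 5 * (5 * k ^ 2 - m * n)" and y: "q2 m n = 5 * (m ^ 2 - 5 * k ^ 2)"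
    unfolding eqs k by Groebner_Basis.algebra+
  have nx: "\<not> 5 dvd 5 * k ^ 2 - m * n"
  proof
    assume "5 dvd 5 * k ^ 2 - m * n"
    then have "5 dvd m * n" by (metis dvd_diff_right_iff dvd_triv_left)
    then show False using K by simp
  qed
  have ny: "\<not> 5 dvd m ^ 2 - 5 * k ^ 2"
  proof
    assume "5 dvd m ^ 2 - 5 * k ^ 2"
    then have "5 dvd m ^ 2" by (metis dvd_diff_left_iff dvd_triv_left)
    then have "5 dvd m" using p5 prime_dvd_power by blast
    then show False using K by simp
  qed
  have "disc W = 5 ^ 3 * (m ^ 10 * (m - n) ^ 10 * n ^ 5 * (2 * m - n) ^ 5
    * (5 * k ^ 2 - m * n) ^ 2 * (m ^ 2 - 5 * k ^ 2))"
    unfolding disc_order_10_model x y by Groebner_Basis.algebra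
  moreover have "(5 :: int) ^ 3 * 5 dvd 5 ^ 12" by simp
  ultimately have "(5 :: int) ^ 3 * 5 dvd 5 ^ 3 * (m ^ 10 * (m - n) ^ 10 * n ^ 5 * (2 * m - n) ^ 5
    * (5 * k ^ 2 - m * n) ^ 2 * (m ^ 2 - 5 * k ^ 2))"
    using d dvd_trans by metis
  then have "5 dvd m ^ 10 * (m - n) ^ 10 * n ^ 5 * (2 * m - n) ^ 5
    * (5 * k ^ 2 - m * n) ^ 2 * (m ^ 2 - 5 * k ^ 2)"
    by (subst (asm) dvd_mult_cancel_left) simp
  then show False
    using K nx ny p5 prime_dvd_mult_iff prime_dvd_power by metis
qed

text \<open>These contradict the third clause of \<open>good_reduction_dvd\<close> at 2: the
  discriminant has more than 12 factors of 2, yet \<open>c4\<close> has exactly 4.\<close>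

lemma even_invariants:
  assumes "even n"
  shows "2 ^ 13 dvd disc W" "\<not> 2 ^ 8 dvd c4 W"
proof -
  have m: "odd m" using assms prime_not_dvd_both[of 2] by auto
  obtain k where k: "n = 2 * k" using assms by blast
  \<comment> \<open>As \<open>m\<close> is odd, one of \<open>k\<close> and \<open>m - k\<close> is
    even; this lifts the valuation beyond 12.\<close>
  have "even (k * (m - k))" using m by auto
  then obtain j where j: "k * (m - k) = 2 * j" by blast
  have "q2 m n = 4 * (m ^ 2 - m * k - k ^ 2)" unfolding q2_def k by Groebner_Basis.algebra
  then have "disc W = 2 ^ 12 * (k * (m - k)) ^ 5
      * (m ^ 10 * (m - n) ^ 10 * q1 m n ^ 2 * (m ^ 2 - m * k - k ^ 2))"
    unfolding disc_order_10_model unfolding k by Groebner_Basis.algebra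
  also have "\<dots> = 2 ^ 13 * (2 ^ 4 * j ^ 5 * (m ^ 10 * (m - n) ^ 10 * q1 m n ^ 2 * (m ^ 2 - m * k - k ^ 2)))"
    unfolding j by Groebner_Basis.algebra
  finally show "2 ^ 13 dvd disc W" by simp
  define w where "w = k * q1 m n + m * (m - k) * (m - n)"
  have w: "odd w" using m k by (auto simp: w_def q1_def)
  have a1: "a1 W = 2 * w" unfolding order_10_model_sel w_def unfolding k by Groebner_Basis.algebra
  have "a2 W = - (4 * (k * (m - k)) * (m ^ 3 * (m - n)))"
    unfolding order_10_model_sel k by Groebner_Basis.algebra
  then have a2: "a2 W = 8 * (- (j * m ^ 3 * (m - n)))" unfolding j by simp
  define e where "e = - (j * m ^ 3 * (m - n))"
  have a3: "a3 W = 16 * (k * q1 m n * e)"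
    using a2 unfolding e_def[symmetric] unfolding order_10_model_sel k by Groebner_Basis.algebra
  have "c4 W = 2 ^ 4 * ((w ^ 2 + 8 * e) ^ 2 - 48 * (w * (k * q1 m n * e)))"
    unfolding c4_def b2_def b4_def a1 a3 order_10_model_sel(4) a2 e_def[symmetric]
    by Groebner_Basis.algebra
  moreover have "odd ((w ^ 2 + 8 * e) ^ 2 - 48 * (w * (k * q1 m n * e)))"
    using w by simp
  ultimately have "\<not> 2 ^ 4 * 2 dvd c4 W" by (simp only: dvd_mult_cancel_left) simp
  moreover have "(2 :: int) ^ 4 * 2 dvd 2 ^ 8" by simp
  ultimately show "\<not> 2 ^ 8 dvd c4 W" using dvd_trans by blast
qed

section \<open>Three bad primes away from the cusps\<close>

context
  assumes nonsingular: "disc W \<noteq> 0"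
begin

lemma noncuspidal: "m \<noteq> 0" "n \<noteq> 0" "m \<noteq> n" "2 * m \<noteq> n"
  using nonsingular by (auto simp: disc_order_10_model)

text \<open>Depending on the parity of \<open>n\<close>, two of the linear factors are odd. If both
  were units, adding or subtracting them would give a cusp.\<close>

lemma odd_prime_dvd_cusp_product:
  obtains p :: nat where "prime p" "p \<noteq> 2" "int p dvd cusp_product"
proof -
  have "\<exists>x. odd x \<and> \<bar>x\<bar> \<noteq> 1 \<and> x dvd cusp_product"
  proof (cases "even n")
    case True
    then have m: "odd m" using prime_not_dvd_both[of 2] by auto
    have "\<not> (\<bar>m\<bar> = 1 \<and> \<bar>m - n\<bar> = 1)" using noncuspidal by linarith
    moreover have "odd (m - n)" using m True by simp
    moreover have "m dvd cusp_product" "m - n dvd cusp_product" by simp_all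
    ultimately show ?thesis using m by metis
  next
    case False
    have "\<not> (\<bar>n\<bar> = 1 \<and> \<bar>2 * m - n\<bar> = 1)" using noncuspidal by linarith
    moreover have "odd (2 * m - n)" using False by simp
    moreover have "n dvd cusp_product" "2 * m - n dvd cusp_product" by simp_all
    ultimately show ?thesis using False by metis
  qed
  then obtain x where "odd x" "\<bar>x\<bar> \<noteq> 1" "x dvd cusp_product" by blast
  then show ?thesis using odd_prime_divisor that dvd_trans by metis
qed

text \<open>Otherwise \<open>q1\<close> and the odd part of \<open>q2\<close> are both units, hence
  equal up to sign. Their sum and difference split into linear factors; each zero is a cusp or makes
  \<open>q1\<close> a multiple of 5.\<close>

lemma odd_prime_dvd_q1_q2:
  obtains p :: nat where "prime p" "p \<noteq> 2" "int p dvd q1 m n * q2 m n"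
proof -
  have mn: "odd m \<or> odd n" using prime_not_dvd_both[of 2] by auto
  then have o1: "odd (q1 m n)" by (auto simp: q1_def)
  have "\<exists>x. odd x \<and> \<bar>x\<bar> \<noteq> 1 \<and> x dvd q1 m n * q2 m n"
  proof (rule ccontr)
    assume "\<not> ?thesis"
    then have unit: "\<bar>x\<bar> = 1" if "odd x" "x dvd q1 m n * q2 m n" for x using that by blast
    have u1: "\<bar>q1 m n\<bar> = 1" using unit o1 by simp
    show False
    proof (cases "even n")
      case True
      then have m: "odd m" using mn by simp
      obtain k where k: "n = 2 * k" using True by blast
      define h where "h = m ^ 2 - m * k - k ^ 2"
      have q: "q2 m n = 4 * h" unfolding h_def q2_def k by Groebner_Basis.algebra
      have "odd h" using m by (auto simp: h_def)
      then have "\<bar>h\<bar> = 1" using unit q by simp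
      then have "h - q1 m n = 0 \<or> h + q1 m n = 0" using u1 by linarith
      moreover have "h - q1 m n = 5 * (k * (m - k))" "h + q1 m n = (2 * m - k) * (m - 3 * k)"
        unfolding h_def q1_def k by Groebner_Basis.algebra+
      ultimately consider "k = 0 \<or> m = k" | "k = 2 * m" | "m = 3 * k" by auto
      then show False
      proof cases
        case 1
        then show False using noncuspidal k by auto
      next
        case 2
        then have "q1 m n = 5 * m ^ 2" unfolding q1_def k by Groebner_Basis.algebra
        then show False using u1 not_five_mult_unit by metis
      next
        case 3
        then have "q1 m n = 5 * - (k ^ 2)" unfolding q1_def k by Groebner_Basis.algebra
        then show False using u1 not_five_mult_unit by metis
      qed
    next
      case False
      then have "odd (q2 m n)" by (simp add: q2_def)
      then have "\<bar>q2 m n\<bar> = 1" using unit by simp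
      then have "q2 m n - q1 m n = 0 \<or> q2 m n + q1 m n = 0" using u1 by linarith
      moreover have "q2 m n - q1 m n = (3 * m - 2 * n) * (m + n)" "q2 m n + q1 m n = 5 * (m * (m - n))"
        unfolding q1_def q2_def by Groebner_Basis.algebra+
      ultimately consider "m = 0 \<or> m = n" | "n = - m" | "3 * m = 2 * n" by force
      then show False
      proof cases
        case 1
        then show False using noncuspidal by auto
      next
        case 2
        then have "q1 m n = 5 * m ^ 2" unfolding q1_def by Groebner_Basis.algebra
        then show False using u1 not_five_mult_unit by metis
      next
        case 3
        define k where "k = n - m"
        have "m = 2 * k" "n = 3 * k" using 3 by (simp_all add: k_def)
        then have "q1 m n = 5 * - (k ^ 2)" unfolding q1_def by Groebner_Basis.algebra
        then show False using u1 not_five_mult_unit by metis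
      qed
    qed
  qed
  then show ?thesis using odd_prime_divisor that dvd_trans by metis
qed

lemma three_bad_primes:
  assumes iso: "weierstrass_iso E (map_weierstrass of_int W)"
  obtains p q :: nat where "prime p" "prime q" "p \<noteq> 2" "q \<noteq> 2" "p \<noteq> q"
    "\<not> good_reduction E 2" "\<not> good_reduction E p" "\<not> good_reduction E q"
proof -
  obtain p :: nat where p: "prime p" "p \<noteq> 2" "int p dvd cusp_product"
    by (rule odd_prime_dvd_cusp_product)
  obtain q :: nat where q: "prime q" "q \<noteq> 2" "int q dvd q1 m n * q2 m n"
    by (rule odd_prime_dvd_q1_q2)
  have ip: "prime (int p)" "prime (int q)" "int p \<noteq> 2" "int q \<noteq> 2" using p q by auto
  have bad: "\<not> good_reduction E r" if "prime r" "int r dvd disc W" "\<not> int r dvd c4 W" for r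
  proof
    assume "good_reduction E r"
    then have "int r ^ 4 dvd c4 W" by (rule good_reduction_dvd(2)[OF iso _ that(1,2)])
    moreover have "int r dvd int r ^ 4" by simp
    ultimately show False using that(3) dvd_trans by blast
  qed
  have K: "r dvd disc W" if "r dvd cusp_product" for r
  proof -
    have "disc W = cusp_product * (m ^ 9 * (m - n) ^ 9 * n ^ 4 * (2 * m - n) ^ 4 * q1 m n ^ 2 * q2 m n)"
      unfolding disc_order_10_model by Groebner_Basis.algebra
    then show ?thesis using that by simp
  qed
  have "p \<noteq> q"
    using prime_dvd_cusp_product_not_dvd_q1 prime_dvd_cusp_product_not_dvd_q2 ip p(3) q(3)
      prime_dvd_mult_iff by blast
  moreover have "\<not> good_reduction E 2"
  proof (cases "even n")
    case True
    have "int 2 dvd disc W" using even_invariants(1)[OF True] dvd_trans[of "2 :: int" "2 ^ 13" "disc W"] by simp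
    then show ?thesis
      using good_reduction_dvd(3)[OF iso, of 2] even_invariants[OF True] by auto
  next
    case False
    \<comment> \<open>For odd \<open>n\<close>, one of \<open>m\<close> and \<open>m - n\<close> is
      even.\<close>
    then have "2 dvd cusp_product" by simp
    then show ?thesis
      using bad[of 2] K prime_dvd_cusp_product_not_dvd_c4[of 2] False by simp
  qed
  moreover have "\<not> good_reduction E p"
    using bad p(1) K[OF p(3)] prime_dvd_cusp_product_not_dvd_c4 ip p(3) by blast
  moreover have "\<not> good_reduction E q"
  proof -
    have "disc W = q1 m n * q2 m n * (m ^ 10 * (m - n) ^ 10 * n ^ 5 * (2 * m - n) ^ 5 * q1 m n)"
      unfolding disc_order_10_model by Groebner_Basis.algebra
    then have d: "int q dvd disc W" using q(3) by simp
    show ?thesis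
    \<comment> \<open>At 5 both invariants may be divisible, and the low valuation of the
      discriminant decides.\<close>
    proof (cases "q = 5")
      case True
      then show ?thesis
        using good_reduction_dvd(1)[OF iso _ q(1) d] five_power_not_dvd_disc q(3) by auto
    next
      case False
      then have "\<not> int q dvd c4 W"
        using prime_dvd_q1_and_c4 prime_dvd_q2_and_c4 ip q(3) prime_dvd_mult_iff
        by (metis of_nat_eq_iff of_nat_numeral)
      then show ?thesis using bad q(1) d by blast
    qed
  qed
  ultimately show ?thesis using that p(1,2) q(1,2) by blast
qed

end

end

theorem theorem3p9:
  shows "\<not> (\<exists>(E :: rat weierstrass) (P :: rat point) (p :: nat) (q :: nat) (\<alpha> :: nat) (\<beta> :: nat).
           elliptic_curve E \<and> on_curve E P \<and> point_has_order E P 10 \<and>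
           prime p \<and> prime q \<and> p \<noteq> q \<and> \<alpha> > 0 \<and> \<beta> > 0 \<and>
           conductor E = p ^ \<alpha> * q ^ \<beta>)"
proof (rule notI, elim exE conjE)
  fix E :: "rat weierstrass" and P :: "rat point" and p q \<alpha> \<beta> :: nat
  assume E: "elliptic_curve E" "on_curve E P" "point_has_order E P 10"
    and pq: "prime p" "prime q" "\<alpha> > 0" and c: "conductor E = p ^ \<alpha> * q ^ \<beta>"
  obtain m n :: int where "coprime m n" and d: "disc (order_10_model m n) \<noteq> 0"
    and iso: "weierstrass_iso E (map_weierstrass of_int (order_10_model m n))"
    using order_10_imp_model[OF E] .
  then interpret coprime_pair m n by unfold_locales
  obtain p' q' :: nat where "prime p'" "prime q'" "p' \<noteq> 2" "q' \<noteq> 2" "p' \<noteq> q'"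
    "\<not> good_reduction E 2" "\<not> good_reduction E p'" "\<not> good_reduction E q'"
    using three_bad_primes[OF d iso] .
  \<comment> \<open>Pigeonhole: 2, \<open>p'\<close> and \<open>q'\<close> are distinct, yet each
    must be \<open>p\<close> or \<open>q\<close>.\<close>
  then show False
    using prime_power_product_dvd[OF c pq, of 2] prime_power_product_dvd[OF c pq, of p']
      prime_power_product_dvd[OF c pq, of q'] by auto
qed

end
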